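(* Let $X$ be an absolutely continuous nonnegative random variable whose CDF $F$ satisfies $F(t)>0$ for all $t>0$, and let $\{X_n,n\ge 1\}$ be the sequence of random variables defined by $X_1\stackrel{D}{=}X$ and $[X_{n+1}\,|\,X_n=t]\stackrel{D}{=}[X_n\,|\,X_n\le t]$ for $t>0$, $n\ge 1$. Then for all $n=1,2,\ldots$, $${\rm cov}(X_n,X_{n+1})={\rm cov}(X_n,X_n-\tilde\mu_n(X_n))={\rm var}(X_n)-{\rm cov}(X_n,\tilde\mu_n(X_n)).$$
   Context: The joint law of $(X_n,X_{n+1})$ is determined by the law of $X_n$ and by the stated conditional law of $X_{n+1}$ given $X_n=t$, which is the law of $X_n$ conditioned on $\{X_n\le t\}$. The CDF $F_n$ of $X_n$ satisfies $F_1=F$, $F_{n+1}=F_n(1-\log F_n)$ on $(0,\infty)$. The mean inactivity time of $X_n$ is $\tilde\mu_n(t)=\mathbb E[t-X_n\,|\,X_n\le t]=\frac{1}{F_n(t)}\int_0^tF_n(x)\,{\rm d}x$, $t>0$. *)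

theory Defs
  imports "HOL-Probability.Probability"
begin

text \<open>The conditional probability measure given the event that \<open>X \<le> t\<close>;
  a probability measure whenever this event has positive probability.\<close>

definition cond_le :: "'a measure \<Rightarrow> ('a \<Rightarrow> real) \<Rightarrow> real \<Rightarrow> 'a measure" where
  "cond_le M X t = uniform_measure M {\<omega> \<in> space M. X \<omega> \<le> t}"

text \<open>\<open>K t\<close> is, for \<open>t \<in> T\<close>, the conditional law of \<open>Y\<close> given \<open>X = t\<close>, in the sense of a regular
  conditional distribution: \<open>K\<close> is a Markov kernel on \<open>T\<close> that disintegrates the joint law of
  \<open>(X, Y)\<close> on the part of the space where \<open>X \<in> T\<close>.\<close>

definition conditional_law_on ::
  "'a measure \<Rightarrow> ('a \<Rightarrow> real) \<Rightarrow> ('a \<Rightarrow> real) \<Rightarrow> real set \<Rightarrow> (real \<Rightarrow> real measure) \<Rightarrow> bool" where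
  "conditional_law_on M Y X T K \<longleftrightarrow>
     K \<in> restrict_space borel T \<rightarrow>\<^sub>M prob_algebra borel \<and>
     (\<forall>A \<in> sets borel. \<forall>B \<in> sets borel. A \<subseteq> T \<longrightarrow>
        emeasure M {\<omega> \<in> space M. X \<omega> \<in> A \<and> Y \<omega> \<in> B} =
        (\<integral>\<^sup>+ t \<in> A. emeasure (K t) B \<partial>distr M borel X))"

definition mean_inactivity_time :: "'a measure \<Rightarrow> ('a \<Rightarrow> real) \<Rightarrow> real \<Rightarrow> real" where
  "mean_inactivity_time M X t = (\<integral>\<omega>. t - X \<omega> \<partial>cond_le M X t)"

definition covariance :: "'a measure \<Rightarrow> ('a \<Rightarrow> real) \<Rightarrow> ('a \<Rightarrow> real) \<Rightarrow> real" where
  "covariance M X Y =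
     (\<integral>\<omega>. (X \<omega> - (\<integral>\<omega>'. X \<omega>' \<partial>M)) * (Y \<omega> - (\<integral>\<omega>'. Y \<omega>' \<partial>M)) \<partial>M)"

text \<open>The Bochner integral is \<open>0\<close> for non-integrable functions, so the following predicate has to
  be stated separately to say that a covariance is meaningful.\<close>

definition covariance_exists :: "'a measure \<Rightarrow> ('a \<Rightarrow> real) \<Rightarrow> ('a \<Rightarrow> real) \<Rightarrow> bool" where
  "covariance_exists M X Y \<longleftrightarrow>
     integrable M X \<and> integrable M Y \<and> integrable M (\<lambda>\<omega>. X \<omega> * Y \<omega>)"

end

theory Submission
  imports Defs
begin

text \<open>Given \<open>X\<^sub>n = t\<close>, the mean of \<open>X\<^sub>n\<^sub>+\<^sub>1\<close> is the mean of \<open>X\<^sub>n\<close> given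
  \<open>X\<^sub>n \<le> t\<close>, which is \<open>t\<close> minus the mean inactivity time at \<open>t\<close>. Disintegrating
  \<open>E X\<^sub>n\<^sub>+\<^sub>1\<close> and \<open>E X\<^sub>n X\<^sub>n\<^sub>+\<^sub>1\<close> over \<open>X\<^sub>n\<close> therefore replaces \<open>X\<^sub>n\<^sub>+\<^sub>1\<close> by this
  function of \<open>X\<^sub>n\<close> in the covariance.\<close>

section \<open>Disintegration of the joint law\<close>

text \<open>The definition of \<open>conditional_law_on\<close> is the case of two indicators. It
  extends to every \<open>g\<close> at once as an equality of two measures on the line, and then to
  \<open>h\<close> by the usual induction on nonnegative measurable functions.\<close>

lemma conditional_law_on_nn_integral:
  fixes X Y :: "'a \<Rightarrow> real" and g h :: "real \<Rightarrow> ennreal"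
  assumes X [measurable]: "X \<in> borel_measurable M" and Y [measurable]: "Y \<in> borel_measurable M"
    and K: "conditional_law_on M Y X T K"
    and T [measurable]: "T \<in> sets borel" and AE_T: "AE \<omega> in M. X \<omega> \<in> T"
    and g [measurable]: "g \<in> borel_measurable borel" and h: "h \<in> borel_measurable borel"
  shows "(\<integral>\<^sup>+\<omega>. g (X \<omega>) * h (Y \<omega>) \<partial>M) = (\<integral>\<^sup>+\<omega>. g (X \<omega>) * (\<integral>\<^sup>+y. h y \<partial>K (X \<omega>)) \<partial>M)"
proof -
  \<comment> \<open>\<open>K\<close> is a kernel only on \<open>T\<close>. Filling in a Dirac
    measure outside \<open>T\<close> gives a kernel on the whole line, and almost surely
    \<open>L (X \<omega>)\<close> is still \<open>K (X \<omega>)\<close>.\<close>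
  define L where "L t = (if t \<in> T then K t else return borel 0)" for t
  have "L \<in> borel \<rightarrow>\<^sub>M prob_algebra borel"
    unfolding L_def
    by (subst measurable_restrict_space_iff[symmetric])
      (use K in \<open>auto simp: conditional_law_on_def space_prob_algebra prob_space_return\<close>)
  then have L [measurable]: "L \<in> borel \<rightarrow>\<^sub>M subprob_algebra borel"
    by (rule measurable_prob_algebraD)
  have AE_L: "AE \<omega> in M. L (X \<omega>) = K (X \<omega>)"
    using AE_T by eventually_elim (simp add: L_def)
  have sets_L [measurable_cong, simp]: "sets (L t) = sets borel" for t
    using measurable_space[OF L, of t] by (simp add: sets_eq_imp_space_eq space_subprob_algebra)
  \<comment> \<open>The definition speaks only of sets \<open>A\<close> inside \<open>T\<close>.
    Passing to \<open>A \<inter> T\<close> discards a null event.\<close>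
  have rectangle: "emeasure M {\<omega> \<in> space M. X \<omega> \<in> A \<and> Y \<omega> \<in> B} =
      (\<integral>\<^sup>+t. emeasure (L t) B * indicator A t \<partial>distr M borel X)"
    if [measurable]: "A \<in> sets borel" "B \<in> sets borel" for A B
  proof -
    have "emeasure M {\<omega> \<in> space M. X \<omega> \<in> A \<and> Y \<omega> \<in> B} =
        emeasure M {\<omega> \<in> space M. X \<omega> \<in> A \<inter> T \<and> Y \<omega> \<in> B}"
      by (rule emeasure_eq_AE) (use AE_T in auto)
    also have "\<dots> = (\<integral>\<^sup>+t. emeasure (K t) B * indicator (A \<inter> T) t \<partial>distr M borel X)"
      by (rule K[unfolded conditional_law_on_def, THEN conjunct2, rule_format]) auto
    also have "\<dots> = (\<integral>\<^sup>+t. emeasure (L t) B * indicator (A \<inter> T) t \<partial>distr M borel X)"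
      by (rule nn_integral_cong) (simp add: L_def split: split_indicator)
    also have "\<dots> = (\<integral>\<^sup>+t. emeasure (L t) B * indicator A t \<partial>distr M borel X)"
      by (rule nn_integral_cong_AE, subst AE_distr_iff)
        (use AE_T in \<open>auto elim!: eventually_mono split: split_indicator\<close>)
    finally show ?thesis .
  qed
  have "(\<integral>\<^sup>+\<omega>. g (X \<omega>) * h (Y \<omega>) \<partial>M) = (\<integral>\<^sup>+\<omega>. g (X \<omega>) * (\<integral>\<^sup>+y. h y \<partial>L (X \<omega>)) \<partial>M)"
    using h
  proof (induction rule: borel_measurable_induct)
    case (cong f f')
    then show ?case by simp
  next
    case (set B)
    then have [measurable]: "B \<in> sets borel" .
    \<comment> \<open>For \<open>h = indicator B\<close> the two sides integrate \<open>g\<close>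
      against these two measures. The rectangle identity says that they agree on every Borel set, so
      no separate induction on \<open>g\<close> arises.\<close>
    have "distr (density M (\<lambda>\<omega>. indicator B (Y \<omega>))) borel X =
        density (distr M borel X) (\<lambda>t. emeasure (L t) B)"
    proof (rule measure_eqI)
      fix A assume "A \<in> sets (distr (density M (\<lambda>\<omega>. indicator B (Y \<omega>))) borel X)"
      then have [measurable]: "A \<in> sets borel" by simp
      have "emeasure (distr (density M (\<lambda>\<omega>. indicator B (Y \<omega>))) borel X) A =
          (\<integral>\<^sup>+\<omega>. indicator B (Y \<omega>) * indicator (X -` A \<inter> space M) \<omega> \<partial>M)"
        by (simp add: emeasure_distr emeasure_density)
      also have "\<dots> = (\<integral>\<^sup>+\<omega>. indicator {\<omega> \<in> space M. X \<omega> \<in> A \<and> Y \<omega> \<in> B} \<omega> \<partial>M)"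
        by (rule nn_integral_cong) (simp split: split_indicator)
      also have "\<dots> = emeasure M {\<omega> \<in> space M. X \<omega> \<in> A \<and> Y \<omega> \<in> B}"
        by simp
      finally show "emeasure (distr (density M (\<lambda>\<omega>. indicator B (Y \<omega>))) borel X) A =
          emeasure (density (distr M borel X) (\<lambda>t. emeasure (L t) B)) A"
        using rectangle[of A B] by (simp add: emeasure_density)
    qed simp
    then have "(\<integral>\<^sup>+t. g t \<partial>distr (density M (\<lambda>\<omega>. indicator B (Y \<omega>))) borel X) =
        (\<integral>\<^sup>+t. g t \<partial>density (distr M borel X) (\<lambda>t. emeasure (L t) B))"
      by simp
    then show ?case
      by (simp add: nn_integral_distr nn_integral_density mult.commute)
  next
    case (mult u c)
    note [measurable] = \<open>u \<in> borel_measurable borel\<close>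
    have "(\<integral>\<^sup>+\<omega>. g (X \<omega>) * (c * u (Y \<omega>)) \<partial>M) = c * (\<integral>\<^sup>+\<omega>. g (X \<omega>) * u (Y \<omega>) \<partial>M)"
      by (simp add: nn_integral_cmult mult.left_commute[of _ c])
    also have "\<dots> = c * (\<integral>\<^sup>+\<omega>. g (X \<omega>) * (\<integral>\<^sup>+y. u y \<partial>L (X \<omega>)) \<partial>M)"
      by (simp only: mult.IH)
    also have "\<dots> = (\<integral>\<^sup>+\<omega>. g (X \<omega>) * (c * (\<integral>\<^sup>+y. u y \<partial>L (X \<omega>))) \<partial>M)"
      by (subst nn_integral_cmult[symmetric]) (simp_all add: mult.left_commute[of _ c])
    also have "\<dots> = (\<integral>\<^sup>+\<omega>. g (X \<omega>) * (\<integral>\<^sup>+y. c * u y \<partial>L (X \<omega>)) \<partial>M)"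
      by (subst nn_integral_cmult) (simp_all cong: measurable_cong_sets)
    finally show ?case .
  next
    case (add u v)
    then show ?case
      by (simp add: nn_integral_add distrib_left)
  next
    case (seq U)
    note [measurable] = \<open>U _ \<in> borel_measurable borel\<close>
    \<comment> \<open>Monotone convergence is applied three times: to the left side, to the outer
      integral on the right, and to the inner integral over \<open>L (X \<omega>)\<close>.\<close>
    have inc: "incseq (\<lambda>i \<omega>. g (X \<omega>) * U i (Y \<omega>))"
      using seq(3) by (auto simp: incseq_def le_fun_def intro!: mult_left_mono)
    have inc_L: "incseq (\<lambda>i \<omega>. g (X \<omega>) * (\<integral>\<^sup>+y. U i y \<partial>L (X \<omega>)))"
      using seq(3) by (auto simp: incseq_def le_fun_def intro!: mult_left_mono nn_integral_mono)
    have "(\<integral>\<^sup>+\<omega>. g (X \<omega>) * (SUP i. U i) (Y \<omega>) \<partial>M) =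
        (SUP i. \<integral>\<^sup>+\<omega>. g (X \<omega>) * U i (Y \<omega>) \<partial>M)"
      using inc by (simp add: nn_integral_monotone_convergence_SUP[symmetric] SUP_mult_left_ennreal image_comp)
    also have "\<dots> = (SUP i. \<integral>\<^sup>+\<omega>. g (X \<omega>) * (\<integral>\<^sup>+y. U i y \<partial>L (X \<omega>)) \<partial>M)"
      using seq by simp
    also have "\<dots> = (\<integral>\<^sup>+\<omega>. g (X \<omega>) * (SUP i. \<integral>\<^sup>+y. U i y \<partial>L (X \<omega>)) \<partial>M)"
      using inc_L by (simp add: nn_integral_monotone_convergence_SUP[symmetric] SUP_mult_left_ennreal)
    also have "\<dots> = (\<integral>\<^sup>+\<omega>. g (X \<omega>) * (\<integral>\<^sup>+y. (SUP i. U i) y \<partial>L (X \<omega>)) \<partial>M)"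
      using seq(3) by (simp add: nn_integral_monotone_convergence_SUP[symmetric] image_comp)
    finally show ?case .
  qed
  also have "\<dots> = (\<integral>\<^sup>+\<omega>. g (X \<omega>) * (\<integral>\<^sup>+y. h y \<partial>K (X \<omega>)) \<partial>M)"
    by (rule nn_integral_cong_AE) (use AE_L in \<open>auto elim!: eventually_mono\<close>)
  finally show ?thesis .
qed

section \<open>The mean inactivity time as a quotient\<close>

text \<open>The quotient formula holds for every real \<open>t\<close>, null conditioning events
  included, so that measurability in \<open>t\<close> can be read off on the whole line.\<close>

lemma mean_inactivity_time_eq:
  assumes [measurable]: "X \<in> borel_measurable M" and "prob_space M"
  shows "mean_inactivity_time M X t =
    (\<integral>\<omega>. indicator {..t} (X \<omega>) * (t - X \<omega>) \<partial>M) / measure M {\<omega> \<in> space M. X \<omega> \<le> t}"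
proof -
  interpret prob_space M by fact
  let ?A = "{\<omega> \<in> space M. X \<omega> \<le> t}"
  show ?thesis
  proof (cases "measure M ?A = 0")
    \<comment> \<open>Both sides are 0: conditioning on a null event leaves no mass, and on the
      right division by 0 yields 0.\<close>
    case True
    then have "AE \<omega> in M. \<not> X \<omega> \<le> t"
      by (subst (asm) prob_eq_0) auto
    then have "AE \<omega> in cond_le M X t. t - X \<omega> = 0"
      unfolding cond_le_def by (intro AE_uniform_measureI) (auto elim!: eventually_mono)
    then have "mean_inactivity_time M X t = 0"
      unfolding mean_inactivity_time_def by (rule integral_eq_zero_AE)
    then show ?thesis using True by simp
  next
    case False
    have eq: "indicator ?A \<omega> / emeasure M ?A = ennreal (indicator ?A \<omega> / measure M ?A)" for \<omega>
      using False by (simp add: emeasure_eq_measure divide_ennreal measure_le_0_iff less_le split: split_indicator flip: ennreal_1)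
    have "mean_inactivity_time M X t = (\<integral>\<omega>. indicator ?A \<omega> / measure M ?A * (t - X \<omega>) \<partial>M)"
      unfolding mean_inactivity_time_def cond_le_def uniform_measure_def eq
      by (subst integral_density) auto
    also have "\<dots> = (\<integral>\<omega>. indicator {..t} (X \<omega>) * (t - X \<omega>) / measure M ?A \<partial>M)"
      by (rule Bochner_Integration.integral_cong) (auto split: split_indicator)
    finally show ?thesis by simp
  qed
qed

lemma borel_measurable_mean_inactivity_time [measurable]:
  assumes [measurable]: "X \<in> borel_measurable M" and "prob_space M"
  shows "mean_inactivity_time M X \<in> borel_measurable borel"
proof -
  interpret prob_space M by fact
  have [measurable]: "(\<lambda>(t, \<omega>). indicator {..t} (X \<omega>) * (t - X \<omega>)) \<in> borel_measurable (borel \<Otimes>\<^sub>M M)"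
  proof -
    \<comment> \<open>The set \<open>{..t}\<close> varies with the argument. As a case distinction
      on \<open>X (snd p) \<le> fst p\<close> the function is visibly jointly measurable, which
      makes the numerator measurable in \<open>t\<close>.\<close>
    have "(\<lambda>(t, \<omega>). indicator {..t} (X \<omega>) * (t - X \<omega>)) =
        (\<lambda>p. if X (snd p) \<le> fst p then fst p - X (snd p) else 0)"
      by (auto simp: fun_eq_iff)
    then show ?thesis by simp
  qed
  have "mono (\<lambda>t. measure M {\<omega> \<in> space M. X \<omega> \<le> t})"
    by (intro monoI finite_measure_mono) auto
  then have [measurable]: "(\<lambda>t. measure M {\<omega> \<in> space M. X \<omega> \<le> t}) \<in> borel_measurable borel"
    by (rule borel_measurable_mono)
  show ?thesis
    unfolding mean_inactivity_time_eq[OF assms, abs_def] by measurable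
qed


text \<open>With \<open>A\<close> the event \<open>X \<le> t\<close>, the number
  \<open>t - mean_inactivity_time M X t\<close> is the expectation of \<open>X\<close> over
  \<open>A\<close> divided by the probability of \<open>A\<close>, that is, the conditional mean.
  Since \<open>X\<close> is positive, that expectation lies between 0 and the full mean of
  \<open>X\<close>; the mean inactivity time itself is nonnegative because \<open>t - X\<close> is
  so on \<open>A\<close>.\<close>

lemma
  assumes [measurable]: "X \<in> borel_measurable M" and "prob_space M"
    and int: "integrable M X" and pos: "AE \<omega> in M. 0 < X \<omega>"
    and p: "0 < measure M {\<omega> \<in> space M. X \<omega> \<le> t}"
  shows nn_integral_cond_le_eq_diff_mean_inactivity_time:
      "(\<integral>\<^sup>+y. ennreal y \<partial>distr (cond_le M X t) borel X) = ennreal (t - mean_inactivity_time M X t)"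
    and diff_mean_inactivity_time_nonneg: "0 \<le> t - mean_inactivity_time M X t"
    and mean_inactivity_time_nonneg: "0 \<le> mean_inactivity_time M X t"
    and diff_mean_inactivity_time_le:
      "t - mean_inactivity_time M X t \<le> (\<integral>\<omega>. X \<omega> \<partial>M) / measure M {\<omega> \<in> space M. X \<omega> \<le> t}"
proof -
  interpret prob_space M by fact
  let ?A = "{\<omega> \<in> space M. X \<omega> \<le> t}"
  let ?f = "\<lambda>\<omega>. indicator ?A \<omega> * X \<omega>"
  have int_f: "integrable M ?f"
    using integrable_mult_indicator[of ?A M X] int by simp
  have "(\<integral>\<omega>. indicator {..t} (X \<omega>) * (t - X \<omega>) \<partial>M) = (\<integral>\<omega>. indicator ?A \<omega> * t - ?f \<omega> \<partial>M)"
    by (rule Bochner_Integration.integral_cong) (auto split: split_indicator)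
  also have "\<dots> = measure M ?A * t - (\<integral>\<omega>. ?f \<omega> \<partial>M)"
    using int_f by (subst Bochner_Integration.integral_diff) (auto simp: emeasure_eq_measure)
  finally have eq: "t - mean_inactivity_time M X t = (\<integral>\<omega>. ?f \<omega> \<partial>M) / measure M ?A"
    using p by (simp add: mean_inactivity_time_eq[OF assms(1,2)] field_simps)
  have f_nonneg: "AE \<omega> in M. 0 \<le> ?f \<omega>"
    using pos by eventually_elim simp
  then have nonneg: "0 \<le> (\<integral>\<omega>. ?f \<omega> \<partial>M)"
    by (rule integral_nonneg_AE)
  then show "0 \<le> t - mean_inactivity_time M X t"
    unfolding eq by simp
  have "(\<integral>\<omega>. ?f \<omega> \<partial>M) \<le> (\<integral>\<omega>. X \<omega> \<partial>M)"
    by (rule integral_mono_AE[OF int_f int])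
      (use pos in \<open>auto elim!: eventually_mono split: split_indicator\<close>)
  then show "t - mean_inactivity_time M X t \<le> (\<integral>\<omega>. X \<omega> \<partial>M) / measure M ?A"
    unfolding eq by (intro divide_right_mono) simp_all
  have "0 \<le> (\<integral>\<omega>. indicator {..t} (X \<omega>) * (t - X \<omega>) \<partial>M)"
    by (rule integral_nonneg_AE) (simp split: split_indicator)
  then show "0 \<le> mean_inactivity_time M X t"
    by (simp add: mean_inactivity_time_eq[OF assms(1,2)])
  have "(\<integral>\<^sup>+y. ennreal y \<partial>distr (cond_le M X t) borel X) =
      (\<integral>\<^sup>+\<omega>. ennreal (X \<omega>) * indicator ?A \<omega> \<partial>M) / emeasure M ?A"
    unfolding cond_le_def by (subst nn_integral_distr) (simp_all add: nn_integral_uniform_measure)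
  also have "(\<integral>\<^sup>+\<omega>. ennreal (X \<omega>) * indicator ?A \<omega> \<partial>M) = (\<integral>\<^sup>+\<omega>. ennreal (?f \<omega>) \<partial>M)"
    by (rule nn_integral_cong) (simp split: split_indicator)
  also have "\<dots> = ennreal (\<integral>\<omega>. ?f \<omega> \<partial>M)"
    by (rule nn_integral_eq_integral[OF int_f f_nonneg])
  finally show "(\<integral>\<^sup>+y. ennreal y \<partial>distr (cond_le M X t) borel X) = ennreal (t - mean_inactivity_time M X t)"
    using p nonneg by (simp add: eq emeasure_eq_measure divide_ennreal)
qed

section \<open>Positivity forced by the conditional law\<close>

text \<open>A kernel into \<open>prob_algebra\<close> has total mass 1 at each point of
  \<open>T\<close>, whereas conditioning on a null event would give the zero measure.\<close>

lemma conditional_law_on_cond_le_pos: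
  assumes [measurable]: "X \<in> borel_measurable M" and "prob_space M"
    and K: "conditional_law_on M Y X T (\<lambda>t. distr (cond_le M X t) borel X)" and t: "t \<in> T"
  shows "0 < measure M {\<omega> \<in> space M. X \<omega> \<le> t}"
proof (rule ccontr)
  interpret prob_space M by fact
  let ?A = "{\<omega> \<in> space M. X \<omega> \<le> t}"
  assume "\<not> 0 < measure M ?A"
  then have "measure M ?A = 0"
    by (simp add: zero_less_measure_iff)
  then have "AE \<omega> in M. \<not> X \<omega> \<le> t"
    by (subst (asm) prob_eq_0) auto
  then have "AE \<omega> in cond_le M X t. False"
    unfolding cond_le_def by (intro AE_uniform_measureI) (auto elim: eventually_mono)
  moreover have "prob_space (distr (cond_le M X t) borel X)"
    using K t by (auto simp: conditional_law_on_def space_restrict_space space_prob_algebra dest: measurable_space)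
  then have "prob_space (cond_le M X t)"
    by (rule prob_space_distrD[rotated]) (simp add: cond_le_def)
  ultimately show False
    using prob_space.AE_False by blast
qed

text \<open>Conditioning \<open>X\<close> on \<open>X \<le> t\<close> keeps it almost surely
  positive, so each kernel measure gives \<open>{..0}\<close> mass 0, and disintegration carries
  this over to \<open>Y\<close>. This is the induction step for positivity along the
  sequence.\<close>

lemma conditional_law_on_cond_le_AE_pos:
  assumes X [measurable]: "X \<in> borel_measurable M" and Y [measurable]: "Y \<in> borel_measurable M"
    and K: "conditional_law_on M Y X {0<..} (\<lambda>t. distr (cond_le M X t) borel X)"
    and pos: "AE \<omega> in M. 0 < X \<omega>"
  shows "AE \<omega> in M. 0 < Y \<omega>"
proof -
  have "(\<integral>\<^sup>+y. indicator {..0} y \<partial>distr (cond_le M X t) borel X) = 0" for t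
  proof -
    have "AE \<omega> in cond_le M X t. 0 < X \<omega>"
      unfolding cond_le_def using pos by (intro AE_uniform_measureI) (auto elim: eventually_mono)
    then have "(\<integral>\<^sup>+\<omega>. indicator {..0} (X \<omega>) \<partial>cond_le M X t) = (\<integral>\<^sup>+\<omega>. 0 \<partial>cond_le M X t)"
      by (intro nn_integral_cong_AE) (auto elim!: eventually_mono split: split_indicator)
    then show ?thesis
      by (subst nn_integral_distr) (simp_all add: cond_le_def)
  qed
  then have "(\<integral>\<^sup>+\<omega>. indicator {..0} (Y \<omega>) \<partial>M) = 0"
    using conditional_law_on_nn_integral[OF X Y K _ _, of "\<lambda>_. 1" "indicator {..0}"] pos by simp
  then have "AE \<omega> in M. indicator {..0} (Y \<omega>) = (0::ennreal)"
    by (subst (asm) nn_integral_0_iff_AE) auto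
  then show ?thesis
    by eventually_elim (simp split: split_indicator_asm)
qed

section \<open>Covariances\<close>

lemma covariance_eq:
  assumes "prob_space M" and "covariance_exists M X Y"
  shows "covariance M X Y = (\<integral>\<omega>. X \<omega> * Y \<omega> \<partial>M) - (\<integral>\<omega>. X \<omega> \<partial>M) * (\<integral>\<omega>. Y \<omega> \<partial>M)"
proof -
  interpret prob_space M by fact
  have [simp]: "integrable M X" "integrable M Y" "integrable M (\<lambda>\<omega>. X \<omega> * Y \<omega>)"
    using assms by (auto simp: covariance_exists_def)
  show ?thesis
    by (simp add: covariance_def algebra_simps prob_space)
qed

text \<open>Positivity of \<open>X\<close> and \<open>Y\<close> lets both moments be computed as
  nonnegative integrals. Integrability of \<open>Y\<close> and of the product \<open>X Y\<close>
  then follows from that of \<open>c (X)\<close> and \<open>X c (X)\<close>.\<close>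

lemma covariance_conditional_law_on_cond_le:
  assumes X [measurable]: "X \<in> borel_measurable M" and Y [measurable]: "Y \<in> borel_measurable M"
    and M: "prob_space M"
    and K: "conditional_law_on M Y X {0<..} (\<lambda>t. distr (cond_le M X t) borel X)"
    and pos: "AE \<omega> in M. 0 < X \<omega>"
    and int: "integrable M X"
  shows "covariance_exists M X Y"
    and "covariance_exists M X (\<lambda>\<omega>. X \<omega> - mean_inactivity_time M X (X \<omega>))"
    and "covariance M X Y = covariance M X (\<lambda>\<omega>. X \<omega> - mean_inactivity_time M X (X \<omega>))"
proof -
  interpret prob_space M by fact
  note [measurable] = borel_measurable_mean_inactivity_time[OF X M]
  define c where "c t = t - mean_inactivity_time M X t" for t
  have [measurable]: "c \<in> borel_measurable borel"
    unfolding c_def by simp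
  note p_pos = conditional_law_on_cond_le_pos[OF X M K]
  note cond_mean = nn_integral_cond_le_eq_diff_mean_inactivity_time[OF X M int pos p_pos, folded c_def]
  define C where "C = 1 + (\<integral>\<omega>. X \<omega> \<partial>M) / measure M {\<omega> \<in> space M. X \<omega> \<le> 1}"
  have EX: "0 \<le> (\<integral>\<omega>. X \<omega> \<partial>M)"
    by (rule integral_nonneg_AE) (use pos in \<open>auto elim: eventually_mono\<close>)
  have c_nonneg: "0 \<le> c t" if "0 < t" for t
    using diff_mean_inactivity_time_nonneg[OF X M int pos p_pos] that by (simp add: c_def)
  \<comment> \<open>A first moment suffices: \<open>c t \<le> t\<close> near \<open>0\<close> and \<open>c t \<le> E X / P (X \<le> 1)\<close> away from \<open>0\<close>,
    so \<open>c\<close> is bounded.\<close>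
  have c_le: "c t \<le> C" if "0 < t" for t
  proof (cases "t \<le> 1")
    case True
    have "c t \<le> t"
      using mean_inactivity_time_nonneg[OF X M int pos p_pos] that by (simp add: c_def)
    moreover have "1 \<le> C"
      using EX by (simp add: C_def)
    ultimately show ?thesis using True by simp
  next
    case False
    have "c t \<le> (\<integral>\<omega>. X \<omega> \<partial>M) / measure M {\<omega> \<in> space M. X \<omega> \<le> t}"
      using diff_mean_inactivity_time_le[OF X M int pos p_pos] that by (simp add: c_def)
    also have "\<dots> \<le> (\<integral>\<omega>. X \<omega> \<partial>M) / measure M {\<omega> \<in> space M. X \<omega> \<le> 1}"
      using False EX p_pos[of 1] by (intro divide_left_mono finite_measure_mono mult_pos_pos p_pos) auto
    finally show ?thesis by (simp add: C_def)
  qed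
  have int_c: "integrable M (\<lambda>\<omega>. c (X \<omega>))"
    by (rule integrable_const_bound[where B = C])
      (use pos in \<open>auto elim!: eventually_mono simp: c_nonneg c_le\<close>)
  have int_Xc: "integrable M (\<lambda>\<omega>. X \<omega> * c (X \<omega>))"
  proof (rule Bochner_Integration.integrable_bound)
    show "integrable M (\<lambda>\<omega>. C * X \<omega>)" using int by simp
    show "AE \<omega> in M. norm (X \<omega> * c (X \<omega>)) \<le> norm (C * X \<omega>)"
      using pos
    proof eventually_elim
      case (elim \<omega>)
      then show ?case
        using c_nonneg[of "X \<omega>"] c_le[of "X \<omega>"]
        by (simp add: abs_mult mult.commute[of C])
    qed
  qed simp
  have Y_pos: "AE \<omega> in M. 0 < Y \<omega>"
    by (rule conditional_law_on_cond_le_AE_pos[OF X Y K pos])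
  \<comment> \<open>The choice \<open>g = 1\<close> gives the mean of \<open>Y\<close>, and
    \<open>g = ennreal\<close> gives the mean of the product.\<close>
  have disint: "(\<integral>\<^sup>+\<omega>. g (X \<omega>) * ennreal (Y \<omega>) \<partial>M) = (\<integral>\<^sup>+\<omega>. g (X \<omega>) * ennreal (c (X \<omega>)) \<partial>M)"
    if "g \<in> borel_measurable borel" for g :: "real \<Rightarrow> ennreal"
  proof -
    have "(\<integral>\<^sup>+\<omega>. g (X \<omega>) * ennreal (Y \<omega>) \<partial>M) =
        (\<integral>\<^sup>+\<omega>. g (X \<omega>) * (\<integral>\<^sup>+y. ennreal y \<partial>distr (cond_le M X (X \<omega>)) borel X) \<partial>M)"
      by (rule conditional_law_on_nn_integral[OF X Y K]) (use that pos in auto)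
    also have "\<dots> = (\<integral>\<^sup>+\<omega>. g (X \<omega>) * ennreal (c (X \<omega>)) \<partial>M)"
      by (rule nn_integral_cong_AE) (use pos in \<open>auto elim!: eventually_mono simp: cond_mean\<close>)
    finally show ?thesis .
  qed
  have "(\<integral>\<^sup>+\<omega>. ennreal (Y \<omega>) \<partial>M) = (\<integral>\<^sup>+\<omega>. ennreal (c (X \<omega>)) \<partial>M)"
    using disint[of "\<lambda>_. 1"] by simp
  also have "\<dots> = ennreal (\<integral>\<omega>. c (X \<omega>) \<partial>M)"
    by (rule nn_integral_eq_integral[OF int_c]) (use pos in \<open>auto elim!: eventually_mono simp: c_nonneg\<close>)
  \<comment> \<open>A finite nonnegative integral yields integrability of \<open>Y\<close> together
    with the value of its mean.\<close>
  finally have Y_int: "has_bochner_integral M Y (\<integral>\<omega>. c (X \<omega>) \<partial>M)"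
  proof (rule has_bochner_integral_nn_integral[rotated 3])
    show "AE \<omega> in M. 0 \<le> Y \<omega>"
      using Y_pos by eventually_elim simp
    show "0 \<le> (\<integral>\<omega>. c (X \<omega>) \<partial>M)"
      by (rule integral_nonneg_AE) (use pos in \<open>auto elim!: eventually_mono simp: c_nonneg\<close>)
  qed simp
  have "(\<integral>\<^sup>+\<omega>. ennreal (X \<omega> * Y \<omega>) \<partial>M) = (\<integral>\<^sup>+\<omega>. ennreal (X \<omega>) * ennreal (Y \<omega>) \<partial>M)"
    by (rule nn_integral_cong_AE) (use pos in \<open>auto elim!: eventually_mono simp: ennreal_mult'\<close>)
  also have "\<dots> = (\<integral>\<^sup>+\<omega>. ennreal (X \<omega>) * ennreal (c (X \<omega>)) \<partial>M)"
    by (rule disint) simp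
  also have "\<dots> = (\<integral>\<^sup>+\<omega>. ennreal (X \<omega> * c (X \<omega>)) \<partial>M)"
    by (rule nn_integral_cong_AE) (use pos in \<open>auto elim!: eventually_mono simp: ennreal_mult'\<close>)
  also have "\<dots> = ennreal (\<integral>\<omega>. X \<omega> * c (X \<omega>) \<partial>M)"
    by (rule nn_integral_eq_integral[OF int_Xc]) (use pos in \<open>auto elim!: eventually_mono simp: c_nonneg\<close>)
  finally have XY_int: "has_bochner_integral M (\<lambda>\<omega>. X \<omega> * Y \<omega>) (\<integral>\<omega>. X \<omega> * c (X \<omega>) \<partial>M)"
  proof (rule has_bochner_integral_nn_integral[rotated 3])
    show "AE \<omega> in M. 0 \<le> X \<omega> * Y \<omega>"
      using pos Y_pos by eventually_elim simp
    show "0 \<le> (\<integral>\<omega>. X \<omega> * c (X \<omega>) \<partial>M)"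
      by (rule integral_nonneg_AE) (use pos in \<open>auto elim!: eventually_mono simp: c_nonneg\<close>)
  qed simp
  show XY: "covariance_exists M X Y"
    using int Y_int XY_int by (simp add: covariance_exists_def has_bochner_integral_iff)
  have Xc: "covariance_exists M X (\<lambda>\<omega>. c (X \<omega>))"
    using int int_c int_Xc by (simp add: covariance_exists_def)
  have "covariance M X Y = covariance M X (\<lambda>\<omega>. c (X \<omega>))"
    using Y_int XY_int by (simp add: covariance_eq[OF M XY] covariance_eq[OF M Xc] has_bochner_integral_iff)
  then show "covariance M X Y = covariance M X (\<lambda>\<omega>. X \<omega> - mean_inactivity_time M X (X \<omega>))"
    by (simp add: c_def)
  show "covariance_exists M X (\<lambda>\<omega>. X \<omega> - mean_inactivity_time M X (X \<omega>))"
    using Xc by (simp add: c_def)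
qed

text \<open>This is linearity in the second argument; the work lies in the existence of the separate
  terms.\<close>

lemma covariance_diff_self:
  assumes "prob_space M" and "covariance_exists M X (\<lambda>\<omega>. X \<omega> - Z \<omega>)"
    and "X \<in> borel_measurable M" and X2: "integrable M (\<lambda>\<omega>. (X \<omega>)\<^sup>2)"
  shows "covariance_exists M X Z"
    and "covariance M X (\<lambda>\<omega>. X \<omega> - Z \<omega>) = prob_space.variance M X - covariance M X Z"
proof -
  interpret prob_space M by fact
  have [simp]: "integrable M X" "integrable M (\<lambda>\<omega>. X \<omega> * (X \<omega> - Z \<omega>))"
    and d: "integrable M (\<lambda>\<omega>. X \<omega> - Z \<omega>)"
    using assms(2) by (auto simp: covariance_exists_def)
  have [simp]: "integrable M Z"
    using Bochner_Integration.integrable_diff[OF \<open>integrable M X\<close> d] by simp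
  \<comment> \<open>The second moment enters here: \<open>X Z\<close> is the difference of
    \<open>X\<^sup>2\<close> and \<open>X (X - Z)\<close>.\<close>
  have [simp]: "integrable M (\<lambda>\<omega>. X \<omega> * Z \<omega>)"
    using Bochner_Integration.integrable_diff[OF X2 \<open>integrable M (\<lambda>\<omega>. X \<omega> * (X \<omega> - Z \<omega>))\<close>]
    by (simp add: algebra_simps power2_eq_square)
  show XZ: "covariance_exists M X Z"
    by (simp add: covariance_exists_def)
  have [simp]: "integrable M (\<lambda>\<omega>. X \<omega> * X \<omega>)"
    using X2 by (simp add: power2_eq_square)
  show "covariance M X (\<lambda>\<omega>. X \<omega> - Z \<omega>) = variance X - covariance M X Z"
    using X2
    by (simp add: covariance_eq[OF assms(1,2)] covariance_eq[OF assms(1) XZ] variance_eq)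
      (simp add: right_diff_distrib power2_eq_square)
qed

section \<open>The sequence of iterated conditionings\<close>

theorem theorem8:
  fixes N :: "'b measure" and X0 :: "'b \<Rightarrow> real"
    and M :: "'a measure" and X :: "nat \<Rightarrow> 'a \<Rightarrow> real"
  assumes "prob_space N" and "X0 \<in> borel_measurable N"
    and abs_cont: "absolutely_continuous lborel (distr N borel X0)"
    and nonneg: "AE \<omega> in N. 0 \<le> X0 \<omega>"
    and cdf_pos: "\<And>t. 0 < t \<Longrightarrow> 0 < cdf (distr N borel X0) t"
    and "prob_space M" and "\<And>n. 1 \<le> n \<Longrightarrow> X n \<in> borel_measurable M"
    and first: "distr M borel (X 1) = distr N borel X0"
    and step: "\<And>n. 1 \<le> n \<Longrightarrow>
      conditional_law_on M (X (n + 1)) (X n) {0<..} (\<lambda>t. distr (cond_le M (X n) t) borel (X n))"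
  shows "\<forall>n\<ge>1.
    (integrable M (X n) \<longrightarrow>
       covariance_exists M (X n) (X (n + 1)) \<and>
       covariance_exists M (X n) (\<lambda>\<omega>. X n \<omega> - mean_inactivity_time M (X n) (X n \<omega>)) \<and>
       covariance M (X n) (X (n + 1)) =
         covariance M (X n) (\<lambda>\<omega>. X n \<omega> - mean_inactivity_time M (X n) (X n \<omega>))) \<and>
    (integrable M (\<lambda>\<omega>. (X n \<omega>)\<^sup>2) \<longrightarrow>
       covariance_exists M (X n) (\<lambda>\<omega>. mean_inactivity_time M (X n) (X n \<omega>)) \<and>
       covariance M (X n) (\<lambda>\<omega>. X n \<omega> - mean_inactivity_time M (X n) (X n \<omega>)) =
         prob_space.variance M (X n) -
         covariance M (X n) (\<lambda>\<omega>. mean_inactivity_time M (X n) (X n \<omega>)))"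
proof (intro allI impI)
  note X_meas [measurable] = \<open>\<And>n. 1 \<le> n \<Longrightarrow> X n \<in> borel_measurable M\<close>
  note M = \<open>prob_space M\<close>
  \<comment> \<open>The conditional laws are prescribed only for \<open>t > 0\<close>, so each
    \<open>X n\<close> has to be almost surely positive, not just nonnegative.\<close>
  have pos: "AE \<omega> in M. 0 < X n \<omega>" if "1 \<le> n" for n
    using that
  proof (induction n rule: dec_induct)
    case base
    note [measurable] = \<open>X0 \<in> borel_measurable N\<close>
    \<comment> \<open>Absolute continuity excludes an atom at 0, since \<open>{0}\<close> is
      Lebesgue null.\<close>
    have "AE x in distr N borel X0. x \<noteq> 0"
      using AE_not_in[of "{0}" "distr N borel X0"] abs_cont finite_imp_null_set_lborel[of "{0}"]
    by (auto simp: absolutely_continuous_def)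
    moreover have "AE x in distr N borel X0. 0 \<le> x"
      using nonneg by (simp add: AE_distr_iff)
    ultimately have "AE x in distr M borel (X 1). 0 < x"
      unfolding first by eventually_elim simp
    then show ?case
      using X_meas[of 1] by (simp add: AE_distr_iff)
  next
    case (step n)
    then show ?case
      using conditional_law_on_cond_le_AE_pos[OF X_meas X_meas assms(9)] by simp
  qed
  fix n :: nat
  assume n: "1 \<le> n"
  note X_n = X_meas[OF n]
  note cov = covariance_conditional_law_on_cond_le[OF X_n X_meas[OF trans_le_add1[OF n]] M step[OF n] pos[OF n]]
  show "(integrable M (X n) \<longrightarrow>
       covariance_exists M (X n) (X (n + 1)) \<and>
       covariance_exists M (X n) (\<lambda>\<omega>. X n \<omega> - mean_inactivity_time M (X n) (X n \<omega>)) \<and>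
       covariance M (X n) (X (n + 1)) =
         covariance M (X n) (\<lambda>\<omega>. X n \<omega> - mean_inactivity_time M (X n) (X n \<omega>))) \<and>
    (integrable M (\<lambda>\<omega>. (X n \<omega>)\<^sup>2) \<longrightarrow>
       covariance_exists M (X n) (\<lambda>\<omega>. mean_inactivity_time M (X n) (X n \<omega>)) \<and>
       covariance M (X n) (\<lambda>\<omega>. X n \<omega> - mean_inactivity_time M (X n) (X n \<omega>)) =
         prob_space.variance M (X n) -
         covariance M (X n) (\<lambda>\<omega>. mean_inactivity_time M (X n) (X n \<omega>)))"
    \<comment> \<open>On a probability space a finite second moment implies a finite first one, so
      \<open>cov(2)\<close> supplies the covariance that \<open>covariance_diff_self\<close>
      splits.\<close>
    using cov covariance_diff_self[OF M cov(2) X_n] finite_measure.square_integrable_imp_integrable[OF prob_space.finite_measure[OF M] X_n]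
    by blast
qed

end
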